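(* Let $A_1,\ldots,A_k$ be real symmetric $n\times n$ matrices and assume that the subspace $\mathcal{V}$ of $M_n(\mathbb{R})$ they span contains a positive definite matrix. The following are equivalent: (i) there exists a nonsingular $A\in\mathcal{V}$ such that $A^{-1}\mathcal{V}$ is a commuting subspace; (ii) for every nonsingular $A\in\mathcal{V}$, $A^{-1}\mathcal{V}$ is a commuting subspace; (iii) there exist real diagonal matrices $\Lambda_i$ and a nonsingular $R\in M_n(\mathbb{R})$ such that $A_i=R\Lambda_iR^T$ for all $i=1,\ldots,k$.
   Context: $A^{-1}\mathcal{V}=\{A^{-1}M: M\in\mathcal{V}\}$. A subspace of matrices is commuting if any two of its elements commute. *)

theory Defs
  imports "HOL-Analysis.Analysis"
begin

definition symmetric_matrix :: "real^'n^'n \<Rightarrow> bool" where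
  "symmetric_matrix M \<longleftrightarrow> transpose M = M"

definition diagonal_matrix :: "real^'n^'n \<Rightarrow> bool" where
  "diagonal_matrix M \<longleftrightarrow> (\<forall>i j. i \<noteq> j \<longrightarrow> M $ i $ j = 0)"

definition positive_definite :: "real^'n^'n \<Rightarrow> bool" where
  "positive_definite M \<longleftrightarrow> symmetric_matrix M \<and> (\<forall>x. x \<noteq> 0 \<longrightarrow> x \<bullet> (M *v x) > 0)"

definition commuting_subspace :: "(real^'n^'n) set \<Rightarrow> bool" where
  "commuting_subspace S \<longleftrightarrow> subspace S \<and> (\<forall>M\<in>S. \<forall>N\<in>S. M ** N = N ** M)"

text \<open>The set \<open>A\<inverse>V = {A\<inverse>M | M \<in> V}\<close>; since \<^const>\<open>matrix_inv\<close> is unspecified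
  on singular matrices, it is meaningful only for invertible \<open>A\<close>.\<close>

definition inv_mult_set :: "real^'n^'n \<Rightarrow> (real^'n^'n) set \<Rightarrow> (real^'n^'n) set" where
  "inv_mult_set A V = {matrix_inv A ** M | M. M \<in> V}"

end

(* Once B^-1 V commutes for one invertible B in V, then C^-1 M = (B^-1 C)^-1 (B^-1 M) shows the
   same for every invertible C in V, in particular for the positive definite P. The maps P^-1 M
   (M in V) are self-adjoint for the inner product x . P y, so they have a common P-orthogonal
   eigenbasis. If S has this basis as columns, then S^T M S is diagonal for every M in V, and
   R = S^-T works; conversely, diagonal matrices commute. *)

theory Submission
  imports Defs
begin

section \<open>Common eigenbases of commuting self-adjoint maps\<close>

text \<open>An abstract inner product beside the Euclidean one, which still supplies compactness and
  continuity. The instance used later is x . P y for a positive definite matrix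
  \<open>P\<close>.\<close>

locale positive_form =
  fixes b :: "'a::euclidean_space \<Rightarrow> 'a \<Rightarrow> real"
  assumes bilinear: "bilinear b"
    and commute: "b x y = b y x"
    and positive: "x \<noteq> 0 \<Longrightarrow> b x x > 0"
begin

lemmas form_simps =
  bilinear_ladd[OF bilinear] bilinear_radd[OF bilinear]
  bilinear_lmul[OF bilinear] bilinear_rmul[OF bilinear]
  bilinear_lsub[OF bilinear] bilinear_rsub[OF bilinear]
  bilinear_lzero[OF bilinear] bilinear_rzero[OF bilinear]

definition selfadjoint :: "('a \<Rightarrow> 'a) \<Rightarrow> bool" where
  "selfadjoint f \<longleftrightarrow> linear f \<and> (\<forall>x y. b (f x) y = b x (f y))"

lemma selfadjoint_eigenvector:
  assumes f: "selfadjoint f" and T: "subspace T" "T \<noteq> {0}" and inv: "f ` T \<subseteq> T"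
  obtains v l where "v \<in> T" "v \<noteq> 0" "f v = l *\<^sub>R v"
proof -
  have lin: "linear f" and sa: "\<And>x y. b (f x) y = b x (f y)"
    using f by (auto simp: selfadjoint_def)
  (* A maximiser of the Rayleigh quotient on the unit sphere of T is an eigenvector. *)
  define K where "K = T \<inter> sphere 0 1"
  have "compact K"
    unfolding K_def by (intro closed_Int_compact closed_subspace T compact_sphere)
  moreover obtain w where w: "w \<in> T" "w \<noteq> 0"
    using T subspace_0 by blast
  then have "(1 / norm w) *\<^sub>R w \<in> K"
    using T by (auto simp: K_def subspace_scale)
  then have "K \<noteq> {}" by blast
  moreover have "continuous_on K (\<lambda>x. b x (f x) / b x x)"
  proof (intro continuous_on_divide ballI)
    show "continuous_on K (\<lambda>x. b x (f x))"
      by (intro bilinear_continuous_on_compose[OF _ _ bilinear] continuous_on_id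
          linear_continuous_on linear_linear[THEN iffD2] lin)
    show "continuous_on K (\<lambda>x. b x x)"
      by (intro bilinear_continuous_on_compose[OF _ _ bilinear] continuous_on_id)
    show "b x x \<noteq> 0" if "x \<in> K" for x
      using that positive[of x] by (force simp: K_def)
  qed
  ultimately obtain v where v: "v \<in> K"
    and max: "\<And>x. x \<in> K \<Longrightarrow> b x (f x) / b x x \<le> b v (f v) / b v v"
    using continuous_attains_sup[of K] by blast
  define l where "l = b v (f v) / b v v"
  have vT: "v \<in> T" and v0: "v \<noteq> 0" using v by (auto simp: K_def)
  have vl: "b v (f v) = l * b v v"
    using positive[OF v0] by (simp add: l_def)
  \<comment> \<open>The quotient is invariant under scaling, so its bound on the Euclidean unit
    sphere extends to all of \<open>T\<close>, although that sphere need not be the unit sphere of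
    \<open>b\<close>.\<close>
  have le: "b x (f x) \<le> l * b x x" if "x \<in> T" for x
  proof (cases "x = 0")
    case True
    then show ?thesis by (simp add: form_simps)
  next
    case False
    let ?y = "(1 / norm x) *\<^sub>R x"
    have "?y \<in> K" using that False T by (auto simp: K_def subspace_scale)
    from max[OF this] have "b x (f x) / b x x \<le> l"
      using False by (simp add: l_def form_simps linear_scale[OF lin])
    then show ?thesis using positive[OF False] by (simp add: field_simps)
  qed
  \<comment> \<open>The residual \<open>u\<close> vanishes exactly when \<open>v\<close> is an
    eigenvector for \<open>l\<close>. It lies in \<open>T\<close>, so \<open>le\<close> applies to
    every perturbation of \<open>v\<close> along \<open>u\<close>.\<close>
  define u where "u = l *\<^sub>R v - f v"
  have uT: "u \<in> T"
    unfolding u_def using vT inv T by (auto intro!: subspace_diff subspace_scale)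
  define q where "q = l * b u u - b u (f u)"
  \<comment> \<open>This is \<open>le\<close> at v + t u, expanded in \<open>t\<close>. The constant
    term vanishes by the choice of \<open>l\<close>. By self-adjointness the two cross terms
    coincide, each being t times \<open>b u u\<close>.\<close>
  have *: "0 \<le> 2 * t * b u u + t\<^sup>2 * q" for t
  proof -
    have "v + t *\<^sub>R u \<in> T"
      using vT uT T by (intro subspace_add subspace_scale)
    from le[OF this]
    have "0 \<le> l * b (v + t *\<^sub>R u) (v + t *\<^sub>R u) - b (v + t *\<^sub>R u) (f (v + t *\<^sub>R u))"
      by simp
    also have "\<dots> = (l * b v v - b v (f v)) + t * (l * b u v - b u (f v))
        + t * (l * b v u - b v (f u)) + t\<^sup>2 * q"
      by (simp add: form_simps linear_add[OF lin] linear_scale[OF lin] q_def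
          algebra_simps power2_eq_square)
    also have "b v (f u) = b u (f v)" using sa commute by metis
    also have "b v u = b u v" by (rule commute)
    also have "l * b u v - b u (f v) = b u u"
      by (subst (4) u_def) (simp add: form_simps)
    finally show ?thesis using vl by simp
  qed
  have "b u u = 0" if "u \<noteq> 0"
  proof (rule ccontr)
    assume "b u u \<noteq> 0"
    then have pos: "b u u > 0" using positive[OF that] by simp
    \<comment> \<open>A small negative \<open>t\<close> lets the linear term win: here t q is at
      least - \<open>b u u\<close>, so 2 \<open>b u u\<close> + t q is still positive.\<close>
    define t where "t = - b u u / (\<bar>q\<bar> + 1)"
    have t: "t < 0" "t * (\<bar>q\<bar> + 1) = - b u u" using pos by (auto simp: t_def)
    have "0 \<le> t * (2 * b u u + t * q)"
      using *[of t] by (simp add: algebra_simps power2_eq_square)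
    then have "2 * b u u + t * q \<le> 0"
      using t(1) by (simp add: zero_le_mult_iff)
    moreover have "t * q \<ge> t * (\<bar>q\<bar> + 1)"
      using t(1) by (intro mult_left_mono_neg) auto
    ultimately show False using t(2) pos by linarith
  qed
  then have "u = 0" using positive[of u] by force
  then show ?thesis using that[OF vT v0, of l] by (simp add: u_def)
qed

lemma common_eigenvector:
  assumes F: "\<And>f. f \<in> F \<Longrightarrow> selfadjoint f"
    and comm: "\<And>f g x. f \<in> F \<Longrightarrow> g \<in> F \<Longrightarrow> f (g x) = g (f x)"
    and S: "subspace S" "S \<noteq> {0}" and inv: "\<And>f. f \<in> F \<Longrightarrow> f ` S \<subseteq> S"
  obtains v where "v \<in> S" "v \<noteq> 0" "\<forall>f\<in>F. \<exists>l. f v = l *\<^sub>R v"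
proof -
  (* In a nonzero invariant subspace T of least dimension, every f in F is a scalar: its eigenspaces
     in T are again invariant under F. *)
  define Q where "Q T \<longleftrightarrow> subspace T \<and> T \<noteq> {0} \<and> T \<subseteq> S \<and> (\<forall>f\<in>F. f ` T \<subseteq> T)" for T
  have "Q S" using S inv by (simp add: Q_def)
  then obtain T where T: "Q T" and min: "\<And>T'. Q T' \<Longrightarrow> dim T \<le> dim T'"
    using ex_has_least_nat[of Q S dim] by blast
  then have sT: "subspace T" and "T \<noteq> {0}" "T \<subseteq> S" and iT: "\<And>f. f \<in> F \<Longrightarrow> f ` T \<subseteq> T"
    by (auto simp: Q_def)
  obtain v where v: "v \<in> T" "v \<noteq> 0"
    using \<open>T \<noteq> {0}\<close> sT subspace_0 by blast
  have "\<exists>l. f v = l *\<^sub>R v" if f: "f \<in> F" for f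
  proof -
    obtain w l where w: "w \<in> T" "w \<noteq> 0" "f w = l *\<^sub>R w"
      using selfadjoint_eigenvector[OF F[OF f] sT \<open>T \<noteq> {0}\<close> iT[OF f]] .
    define E where "E = {x \<in> T. f x = l *\<^sub>R x}"
    have lin: "linear g" if "g \<in> F" for g using F[OF that] by (simp add: selfadjoint_def)
    have "subspace E"
      unfolding E_def subspace_def using sT lin[OF f]
      by (auto simp: subspace_0 subspace_add subspace_scale linear_0 linear_add linear_scale
          algebra_simps)
    moreover have "g ` E \<subseteq> E" if "g \<in> F" for g
      using iT[OF that] comm[OF f that] linear_scale[OF lin[OF that]] by (auto simp: E_def)
    moreover have "E \<noteq> {0}" "E \<subseteq> T" using w by (auto simp: E_def)
    ultimately have "Q E" using \<open>T \<subseteq> S\<close> by (auto simp: Q_def)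
    then have "E = T"
      using min \<open>E \<subseteq> T\<close> \<open>subspace E\<close> sT subspace_dim_equal by metis
    then show ?thesis using v(1) by (auto simp: E_def)
  qed
  then show ?thesis using that v \<open>T \<subseteq> S\<close> by blast
qed

text \<open>Induction on the dimension: split off a common eigenvector \<open>v\<close> and continue
  in its \<open>b\<close>-orthogonal complement inside \<open>S\<close>. Self-adjointness keeps this
  complement invariant; hence the formulation for arbitrary invariant subspaces.\<close>

lemma common_orthogonal_eigenbasis:
  assumes F: "\<And>f. f \<in> F \<Longrightarrow> selfadjoint f"
    and comm: "\<And>f g x. f \<in> F \<Longrightarrow> g \<in> F \<Longrightarrow> f (g x) = g (f x)"
    and S: "subspace S" and inv: "\<And>f. f \<in> F \<Longrightarrow> f ` S \<subseteq> S"
  shows "\<exists>B. independent B \<and> span B = S \<and> pairwise (\<lambda>x y. b x y = 0) B \<and>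
           (\<forall>f\<in>F. \<forall>x\<in>B. \<exists>l. f x = l *\<^sub>R x)"
  using S inv
proof (induction "dim S" arbitrary: S rule: less_induct)
  case less
  show ?case
  proof (cases "S = {0}")
    case True
    then show ?thesis by (intro exI[of _ "{}"]) (auto simp: independent_empty)
  next
    case False
    obtain v where v: "v \<in> S" "v \<noteq> 0" "\<forall>f\<in>F. \<exists>l. f v = l *\<^sub>R v"
      by (rule common_eigenvector[of F S]) (use F comm less.prems False in blast)+
    define T where "T = {x \<in> S. b x v = 0}"
    have sT: "subspace T"
      unfolding T_def subspace_def using less.prems(1)
      by (auto simp: form_simps subspace_0 subspace_add subspace_scale)
    have vT: "v \<notin> T" using positive[OF v(2)] by (simp add: T_def)
    have "T \<subseteq> S" by (auto simp: T_def)
    with vT v(1) have "T \<subset> S" by blast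
    then have "dim T < dim S"
      using dim_psubset[of T S] sT less.prems(1) by (simp add: span_eq_iff[THEN iffD2])
    moreover have "f ` T \<subseteq> T" if f: "f \<in> F" for f
    proof -
      obtain l where "f v = l *\<^sub>R v" using v(3) f by blast
      then have "b (f x) v = l * b x v" for x
        using F[OF f] by (simp add: selfadjoint_def form_simps)
      then show ?thesis using less.prems(2)[OF f] by (auto simp: T_def)
    qed
    ultimately obtain B where B: "independent B" "span B = T"
      "pairwise (\<lambda>x y. b x y = 0) B" "\<forall>f\<in>F. \<forall>x\<in>B. \<exists>l. f x = l *\<^sub>R x"
      using less.hyps[OF _ sT] by blast
    have BT: "B \<subseteq> T" using B(2) span_superset by blast
    have "span (insert v B) = S"
    proof (rule subset_antisym)
      show "span (insert v B) \<subseteq> S"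
        using v(1) BT \<open>T \<subseteq> S\<close> less.prems(1) by (intro span_minimal) auto
      show "S \<subseteq> span (insert v B)"
      proof
        fix x assume x: "x \<in> S"
        \<comment> \<open>The Gram-Schmidt coefficient, which makes the remainder
          \<open>b\<close>-orthogonal to \<open>v\<close>.\<close>
        let ?c = "b x v / b v v"
        have "x - ?c *\<^sub>R v \<in> T"
          using x v(1) less.prems(1) positive[OF v(2)]
          by (auto simp: T_def form_simps subspace_diff subspace_scale)
        then show "x \<in> span (insert v B)" using B(2) by (auto simp: span_insert)
      qed
    qed
    moreover have "independent (insert v B)"
      using B vT by (simp add: independent_insertI)
    moreover have "pairwise (\<lambda>x y. b x y = 0) (insert v B)"
      using B(3) BT commute[of v] by (auto simp: pairwise_insert T_def)
    ultimately show ?thesis using B(4) v(3) by (intro exI[of _ "insert v B"]) auto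
  qed
qed

end

section \<open>Matrix inverses and the form of a positive definite matrix\<close>

text \<open>The last four equations allow cancellation inside longer products, whether nested to the
  right or to the left.\<close>

lemma matrix_inv_mult_cancel [simp]:
  fixes B :: "real^'n^'n"
  assumes "invertible B"
  shows "matrix_inv B ** B = mat 1" "B ** matrix_inv B = mat 1"
    "matrix_inv B ** (B ** M) = M" "B ** (matrix_inv B ** M) = M"
    "M ** B ** matrix_inv B = M" "M ** matrix_inv B ** B = M"
proof -
  show *: "matrix_inv B ** B = mat 1" "B ** matrix_inv B = mat 1"
    using assms unfolding invertible_def matrix_inv_def by (metis (mono_tags, lifting) someI_ex)+
  show "matrix_inv B ** (B ** M) = M" "B ** (matrix_inv B ** M) = M"
    by (simp_all add: matrix_mul_assoc *)
  show "M ** B ** matrix_inv B = M" "M ** matrix_inv B ** B = M"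
    by (simp_all add: * flip: matrix_mul_assoc)
qed

text \<open>A nonzero kernel vector x would give x . P x = 0.\<close>

lemma invertible_positive_definite:
  assumes "positive_definite P"
  shows "invertible P"
proof -
  have "x = 0" if "P *v x = 0" for x
    using assms that by (force simp: positive_definite_def)
  then show ?thesis
    using matrix_left_invertible_ker[of P] invertible_left_inverse[of P] by blast
qed

lemma symmetric_matrix_inner:
  assumes "symmetric_matrix M"
  shows "x \<bullet> (M *v y) = y \<bullet> (M *v x)"
  using dot_lmul_matrix[of x M y] assms
  by (metis inner_commute symmetric_matrix_def vector_transpose_matrix)

lemma positive_form_matrix:
  assumes "positive_definite P"
  shows "positive_form (\<lambda>x y. x \<bullet> (P *v y))"
proof
  show "bilinear (\<lambda>x y. x \<bullet> (P *v y))"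
    by (auto simp: bilinear_def intro!: linearI simp: inner_left_distrib inner_right_distrib
        matrix_vector_right_distrib matrix_vector_mult_scaleR)
qed (use assms symmetric_matrix_inner in \<open>auto simp: positive_definite_def\<close>)

section \<open>Independence of the chosen invertible matrix\<close>

text \<open>Left multiplication by \<open>matrix_inv B\<close> is linear, so the subspace half of
  the definition is automatic. In the commutation half the leading \<open>matrix_inv B\<close>
  cancels, which leaves the more convenient condition used from here on.\<close>

lemma commuting_inv_mult_set_iff:
  fixes B :: "real^'n^'n"
  assumes "subspace V" and B: "invertible B"
  shows "commuting_subspace (inv_mult_set B V) \<longleftrightarrow>
    (\<forall>M\<in>V. \<forall>N\<in>V. M ** matrix_inv B ** N = N ** matrix_inv B ** M)"
proof -
  have eq: "inv_mult_set B V = (\<lambda>M. matrix_inv B ** M) ` V"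
    by (auto simp: inv_mult_set_def)
  have "linear (\<lambda>M. matrix_inv B ** M)"
    by (auto intro!: linearI simp: matrix_add_ldistrib matrix_scalar_ac scalar_matrix_assoc)
  then have "subspace (inv_mult_set B V)"
    using assms(1) linear_subspace_image by (metis eq)
  moreover have "(matrix_inv B ** M) ** (matrix_inv B ** N) = (matrix_inv B ** N) ** (matrix_inv B ** M)
      \<longleftrightarrow> M ** matrix_inv B ** N = N ** matrix_inv B ** M" for M N
    using matrix_inv_mult_cancel(4)[OF B] by (metis matrix_mul_assoc)
  ultimately show ?thesis
    by (simp add: commuting_subspace_def eq)
qed

lemma commuting_inv_mult_set_transfer:
  fixes B C :: "real^'n^'n"
  assumes V: "subspace V" and B: "invertible B" "B \<in> V" and C: "invertible C" "C \<in> V"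
    and comm: "commuting_subspace (inv_mult_set B V)"
  shows "commuting_subspace (inv_mult_set C V)"
proof -
  define b c where "b = matrix_inv B" and "c = matrix_inv C"
  note bc = matrix_inv_mult_cancel[OF B(1), folded b_def] matrix_inv_mult_cancel[OF C(1), folded c_def]
  have *: "M ** b ** N = N ** b ** M" if "M \<in> V" "N \<in> V" for M N
    using comm that commuting_inv_mult_set_iff[OF V B(1)] by (auto simp: b_def)
  have swap: "M ** c ** B = B ** c ** M" if "M \<in> V" for M
  proof -
    \<comment> \<open>Pad \<open>M\<close> to M b C c B. Once \<open>*\<close> has exchanged
      \<open>M\<close> and \<open>C\<close>, the factors c C and B b cancel on the left.\<close>
    have "B ** c ** M = B ** c ** (M ** b ** C) ** c ** B"
      using bc by (simp flip: matrix_mul_assoc)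
    also have "M ** b ** C = C ** b ** M" using * that C(2) by blast
    also have "B ** c ** (C ** b ** M) ** c ** B = M ** c ** B"
      using bc by (simp flip: matrix_mul_assoc)
    finally show ?thesis by simp
  qed
  have "M ** c ** N = N ** c ** M" if "M \<in> V" "N \<in> V" for M N
  proof -
    \<comment> \<open>Insert B b before \<open>N\<close>, bring \<open>B\<close> to the front by
      \<open>swap\<close>, exchange \<open>M\<close> and \<open>N\<close> across \<open>b\<close> by
      \<open>*\<close>, and move \<open>B\<close> back by \<open>swap\<close>.\<close>
    have "M ** c ** N = (M ** c ** B) ** b ** N"
      using bc by (simp flip: matrix_mul_assoc)
    also have "\<dots> = B ** c ** (M ** b ** N)"
      using swap[OF that(1)] by (simp add: matrix_mul_assoc)
    also have "\<dots> = B ** c ** N ** b ** M"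
      using *[OF that] by (simp add: matrix_mul_assoc)
    also have "\<dots> = N ** c ** M"
      using bc swap[OF that(2)] by metis
    finally show ?thesis .
  qed
  then show ?thesis
    using commuting_inv_mult_set_iff[OF V C(1)] by (auto simp: c_def)
qed

section \<open>Simultaneous diagonalisation by congruence\<close>

text \<open>Turns diagonality of a congruent matrix into orthogonality of distinct columns of
  \<open>S\<close> with respect to x . M y.\<close>

lemma congruence_entry:
  fixes S M :: "real^'n^'n"
  shows "(transpose S ** M ** S) $ i $ j = column i S \<bullet> (M *v column j S)"
proof -
  have "(transpose S ** M ** S) $ i $ j = axis i 1 \<bullet> ((transpose S ** M ** S) *v axis j 1)"
    by (simp add: inner_axis' matrix_vector_mult_basis column_def)
  also have "\<dots> = axis i 1 \<bullet> (transpose S *v (M *v (S *v axis j 1)))"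
    by (simp only: matrix_vector_mul_assoc matrix_mul_assoc)
  also have "\<dots> = (S *v axis i 1) \<bullet> (M *v (S *v axis j 1))"
    by (simp only: vector_transpose_matrix flip: dot_lmul_matrix)
  finally show ?thesis by (simp add: matrix_vector_mult_basis)
qed

lemma simultaneous_congruence_diagonal:
  fixes V :: "(real^'n^'n) set"
  assumes V: "\<And>M. M \<in> V \<Longrightarrow> symmetric_matrix M"
    and P: "positive_definite P"
    and comm: "\<And>M N. M \<in> V \<Longrightarrow> N \<in> V \<Longrightarrow>
      M ** matrix_inv P ** N = N ** matrix_inv P ** M"
  obtains S :: "real^'n^'n" where "invertible S" "\<And>M. M \<in> V \<Longrightarrow> diagonal_matrix (transpose S ** M ** S)"
proof -
  interpret positive_form "\<lambda>x y. x \<bullet> (P *v y)" by (rule positive_form_matrix[OF P])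
  have invP: "invertible P" by (rule invertible_positive_definite[OF P])
  define f where "f M x = (matrix_inv P ** M) *v x" for M :: "real^'n^'n" and x
  have Pf: "P *v f M x = M *v x" for M x
    using invP by (simp add: f_def matrix_vector_mul_assoc)
  have "\<exists>B. independent B \<and> span B = UNIV \<and> pairwise (\<lambda>x y. x \<bullet> (P *v y) = 0) B \<and>
      (\<forall>g\<in>f ` V. \<forall>x\<in>B. \<exists>l. g x = l *\<^sub>R x)"
  proof (rule common_orthogonal_eigenbasis)
    fix g assume "g \<in> f ` V"
    then obtain M where M: "M \<in> V" "g = f M" by blast
    have "linear (f M)" unfolding f_def by simp
    moreover have "f M x \<bullet> (P *v y) = x \<bullet> (P *v f M y)" for x y
    proof -
      \<comment> \<open>\<open>P\<close> cancels the inverse in \<open>f M\<close>, so both sides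
        reduce to the symmetric form of \<open>M\<close>.\<close>
      have "f M x \<bullet> (P *v y) = y \<bullet> (M *v x)"
        using P symmetric_matrix_inner[of P "f M x" y] by (simp add: positive_definite_def Pf)
      also have "\<dots> = x \<bullet> (P *v f M y)"
        using symmetric_matrix_inner[OF V[OF M(1)]] by (simp add: Pf)
      finally show ?thesis .
    qed
    ultimately show "selfadjoint g" by (simp add: selfadjoint_def M)
  next
    fix g h x assume "g \<in> f ` V" "h \<in> f ` V"
    then show "g (h x) = h (g x)"
      using comm by (auto simp: f_def matrix_vector_mul_assoc simp flip: matrix_mul_assoc)
  qed auto
  then obtain B where B: "independent B" "span B = UNIV" "pairwise (\<lambda>x y. x \<bullet> (P *v y) = 0) B"
    and eig: "\<And>M x. M \<in> V \<Longrightarrow> x \<in> B \<Longrightarrow> \<exists>l. f M x = l *\<^sub>R x"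
    by auto
  \<comment> \<open>The basis has as many elements as the index type, so its vectors can serve as
    the columns of a square matrix.\<close>
  have "finite B" "card B = CARD('n)"
    using B(1,2) independent_bound dim_eq_card[of B UNIV] by auto
  then obtain h :: "'n \<Rightarrow> real^'n" where h: "bij_betw h UNIV B"
    by (metis finite_same_card_bij finite_class.finite_UNIV)
  define S :: "real^'n^'n" where "S = (\<chi> i j. h j $ i)"
  have col: "column j S = h j" for j by (simp add: S_def column_def vec_eq_iff)
  have "columns S = B"
    using h by (auto simp: columns_def col bij_betw_def)
  then have "invertible S"
    using B(2) matrix_right_invertible_span_columns[of S] invertible_right_inverse[of S] by (simp add: span_vec_eq)
  moreover have "diagonal_matrix (transpose S ** M ** S)" if M: "M \<in> V" for M
    unfolding diagonal_matrix_def congruence_entry col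
  proof (intro allI impI)
    fix i j :: 'n assume "i \<noteq> j"
    then have ij: "h i \<in> B" "h j \<in> B" "h i \<noteq> h j"
      using h by (auto simp: bij_betw_def inj_eq)
    then obtain l where "f M (h j) = l *\<^sub>R h j" using eig[OF M] by blast
    \<comment> \<open>The generalised eigenvalue equation M x = l P x: orthogonality for
      \<open>P\<close> therefore forces orthogonality for \<open>M\<close>.\<close>
    then have "M *v h j = l *\<^sub>R (P *v h j)"
      by (metis Pf matrix_vector_mult_scaleR)
    then show "h i \<bullet> (M *v h j) = 0"
      using B(3) ij by (auto simp: pairwise_def)
  qed
  ultimately show ?thesis using that by blast
qed

section \<open>Matrices congruent to diagonal ones\<close>

lemma diagonal_matrix_mult_commute:
  fixes D E :: "real^'n^'n"
  assumes "diagonal_matrix D" "diagonal_matrix E"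
  shows "D ** E = E ** D"
proof -
  \<comment> \<open>The products agree summand by summand, since a summand can be nonzero only for i
    = k = j.\<close>
  have "D $ i $ k * E $ k $ j = E $ i $ k * D $ k $ j" for i j k
    using assms by (cases "i = k"; cases "k = j") (auto simp: diagonal_matrix_def)
  then show ?thesis by (simp add: matrix_matrix_mult_def)
qed

lemma matrix_add_rdistrib:
  fixes A B :: "'a::semiring_1^'n^'m"
  shows "(A + B) ** C = A ** C + B ** C"
  by (simp add: matrix_matrix_mult_def vec_eq_iff distrib_right sum.distrib)

text \<open>Lets a factorisation of the generators \<open>A i\<close> with a fixed \<open>R\<close>
  pass to their whole span.\<close>

lemma subspace_congruent_diagonal:
  fixes R :: "real^'n^'n"
  shows "subspace {R ** D ** transpose R | D. diagonal_matrix D}" (is "subspace ?W")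
proof (rule subspaceI)
  show "0 \<in> ?W"
    by (rule CollectI, rule exI[of _ 0]) (simp add: diagonal_matrix_def)
next
  fix x y assume "x \<in> ?W" "y \<in> ?W"
  then obtain D E where "x = R ** D ** transpose R" "y = R ** E ** transpose R"
    "diagonal_matrix D" "diagonal_matrix E" by blast
  then have "x + y = R ** (D + E) ** transpose R \<and> diagonal_matrix (D + E)"
    by (simp add: diagonal_matrix_def matrix_add_ldistrib matrix_add_rdistrib)
  then show "x + y \<in> ?W" by blast
next
  fix c :: real and x assume "x \<in> ?W"
  then obtain D where "x = R ** D ** transpose R" "diagonal_matrix D" by blast
  then have "c *\<^sub>R x = R ** (c *\<^sub>R D) ** transpose R \<and> diagonal_matrix (c *\<^sub>R D)"
    by (simp add: diagonal_matrix_def matrix_scalar_ac scalar_matrix_assoc)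
  then show "c *\<^sub>R x \<in> ?W" by blast
qed

lemma congruent_diagonal_commute:
  fixes R :: "real^'n^'n"
  assumes R: "invertible R" and B: "invertible B"
    and "B = R ** D ** transpose R" "M = R ** E ** transpose R" "N = R ** F ** transpose R"
    and "diagonal_matrix D" "diagonal_matrix E" "diagonal_matrix F"
  shows "M ** matrix_inv B ** N = N ** matrix_inv B ** M"
proof -
  \<comment> \<open>\<open>G\<close> is the inverse of \<open>D\<close>, written through
    \<open>B\<close>. It commutes with diagonal matrices because \<open>D\<close> does, so its own
    diagonality need not be shown.\<close>
  define G where "G = transpose R ** matrix_inv B ** R"
  have R': "invertible (transpose R)" using R by (simp add: transpose_invertible)
  have D: "D = matrix_inv R ** B ** matrix_inv (transpose R)"
    using R R' assms(3) by (simp flip: matrix_mul_assoc)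
  have DG: "D ** G = mat 1" "G ** D = mat 1"
    using R R' B by (simp_all add: D G_def flip: matrix_mul_assoc)
  have GE: "G ** E = E ** G"
    using DG diagonal_matrix_mult_commute[OF assms(6,7)]
    by (metis matrix_mul_assoc matrix_mul_lid matrix_mul_rid)
  have GF: "G ** F = F ** G"
    using DG diagonal_matrix_mult_commute[OF assms(6,8)]
    by (metis matrix_mul_assoc matrix_mul_lid matrix_mul_rid)
  have "E ** G ** F = F ** G ** E"
    using GE GF diagonal_matrix_mult_commute[OF assms(7,8)] by (metis matrix_mul_assoc)
  moreover have "M ** matrix_inv B ** N = R ** (E ** G ** F) ** transpose R"
    "N ** matrix_inv B ** M = R ** (F ** G ** E) ** transpose R"
    by (simp_all add: assms(4,5) G_def matrix_mul_assoc)
  ultimately show ?thesis by simp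
qed

section \<open>The three equivalent conditions\<close>

theorem theorem2p13:
  fixes A :: "nat \<Rightarrow> real^'n^'n" and k :: nat and V :: "(real^'n^'n) set"
  assumes sym: "\<And>i. i \<in> {1..k} \<Longrightarrow> symmetric_matrix (A i)"
    and V: "V = span (A ` {1..k})"
    and pd: "\<exists>P\<in>V. positive_definite P"
  shows "((\<exists>B\<in>V. invertible B \<and> commuting_subspace (inv_mult_set B V)) \<longleftrightarrow>
          (\<forall>B\<in>V. invertible B \<longrightarrow> commuting_subspace (inv_mult_set B V))) \<and>
         ((\<forall>B\<in>V. invertible B \<longrightarrow> commuting_subspace (inv_mult_set B V)) \<longleftrightarrow>
          (\<exists>(\<Lambda> :: nat \<Rightarrow> real^'n^'n) (R :: real^'n^'n).
             invertible R \<and> (\<forall>i\<in>{1..k}. diagonal_matrix (\<Lambda> i)) \<and>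
             (\<forall>i\<in>{1..k}. A i = R ** \<Lambda> i ** transpose R)))"
proof -
  let ?comm = "\<lambda>B. commuting_subspace (inv_mult_set B V)"
  have sV: "subspace V" by (simp add: V)
  have AV: "A i \<in> V" if "i \<in> {1..k}" for i using that by (simp add: V span_base)
  obtain P where P: "P \<in> V" "positive_definite P" using pd by blast
  have invP: "invertible P" by (rule invertible_positive_definite[OF P(2)])
  have all: "\<forall>C\<in>V. invertible C \<longrightarrow> ?comm C" if "B \<in> V" "invertible B" "?comm B" for B
    using commuting_inv_mult_set_transfer[OF sV that(2,1) _ _ that(3)] by blast
  have "subspace {M :: real^'n^'n. symmetric_matrix M}"
    by (auto simp: subspace_def symmetric_matrix_def transpose_def vec_eq_iff)
  then have symV: "symmetric_matrix M" if "M \<in> V" for M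
    using span_minimal[of "A ` {1..k}" "{M. symmetric_matrix M}"] sym that V by blast
  \<comment> \<open>Both links with (iii), \<open>diag\<close> and \<open>comm\<close>, go through
    the single matrix \<open>P\<close>; \<open>all\<close> spreads commutativity from
    \<open>P\<close> to every invertible element of \<open>V\<close>.\<close>
  have diag: "\<exists>(\<Lambda> :: nat \<Rightarrow> real^'n^'n) (R :: real^'n^'n).
      invertible R \<and> (\<forall>i\<in>{1..k}. diagonal_matrix (\<Lambda> i)) \<and>
      (\<forall>i\<in>{1..k}. A i = R ** \<Lambda> i ** transpose R)" if "?comm P"
  proof -
    have "\<forall>M\<in>V. \<forall>N\<in>V. M ** matrix_inv P ** N = N ** matrix_inv P ** M"
      using that commuting_inv_mult_set_iff[OF sV invP] by (rule rev_iffD1)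
    then obtain S :: "real^'n^'n" where S: "invertible S"
      and d: "\<And>M. M \<in> V \<Longrightarrow> diagonal_matrix (transpose S ** M ** S)"
      using simultaneous_congruence_diagonal[of V P, OF symV P(2)] by metis
    \<comment> \<open>With this choice \<open>R\<close> inverts \<open>transpose S\<close> and
      \<open>transpose R\<close> inverts \<open>S\<close>, so \<open>R\<close> undoes the congruence
      by \<open>S\<close>.\<close>
    define R where "R = matrix_inv (transpose S)"
    have S': "invertible (transpose S)" using S by (simp add: transpose_invertible)
    have "S ** transpose R = mat 1"
      using S' by (metis R_def matrix_inv_mult_cancel(1) matrix_transpose_mul transpose_mat
          transpose_transpose)
    then have "R ** (transpose S ** M ** S) ** transpose R = M" for M
      using S' by (simp add: R_def flip: matrix_mul_assoc)
    moreover have "invertible R"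
      using matrix_inv_mult_cancel(1,2)[OF S'] by (auto simp: R_def invertible_def)
    ultimately show ?thesis
      using d AV by (intro exI[of _ "\<lambda>i. transpose S ** A i ** S"] exI[of _ R]) auto
  qed
  have comm: "?comm P" if R: "invertible R" "\<forall>i\<in>{1..k}. diagonal_matrix (\<Lambda> i)"
    "\<forall>i\<in>{1..k}. A i = R ** \<Lambda> i ** transpose R" for \<Lambda> :: "nat \<Rightarrow> real^'n^'n" and R
  proof -
    \<comment> \<open>\<open>P\<close> is in \<open>V\<close> as well, so the base matrix and both
      factors are diagonalised by the same \<open>R\<close>.\<close>
    have sub: "V \<subseteq> {R ** D ** transpose R | D. diagonal_matrix D}"
      unfolding V using R by (intro span_minimal subspace_congruent_diagonal) auto
    have "M ** matrix_inv P ** N = N ** matrix_inv P ** M" if MN: "M \<in> V" "N \<in> V" for M N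
    proof -
      obtain D E F where "P = R ** D ** transpose R" "diagonal_matrix D"
        "M = R ** E ** transpose R" "diagonal_matrix E"
        "N = R ** F ** transpose R" "diagonal_matrix F"
        using sub[THEN subsetD, OF P(1)] sub[THEN subsetD, OF MN(1)] sub[THEN subsetD, OF MN(2)]
        by blast
      then show ?thesis by (intro congruent_diagonal_commute[OF R(1) invP])
    qed
    then show ?thesis by (simp add: commuting_inv_mult_set_iff[OF sV invP])
  qed
  show ?thesis
  proof (intro conjI iffI)
    assume "\<exists>B\<in>V. invertible B \<and> ?comm B"
    then show "\<forall>B\<in>V. invertible B \<longrightarrow> ?comm B" using all by (elim bexE conjE)
  next
    assume *: "\<forall>B\<in>V. invertible B \<longrightarrow> ?comm B"
    \<comment> \<open>\<open>P\<close> supplies the invertible element of \<open>V\<close> that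
      keeps (ii) from being vacuous.\<close>
    then have "?comm P" using P(1) invP by simp
    then show "\<exists>B\<in>V. invertible B \<and> ?comm B"
      "\<exists>(\<Lambda> :: nat \<Rightarrow> real^'n^'n) (R :: real^'n^'n).
        invertible R \<and> (\<forall>i\<in>{1..k}. diagonal_matrix (\<Lambda> i)) \<and>
        (\<forall>i\<in>{1..k}. A i = R ** \<Lambda> i ** transpose R)"
      using P(1) invP diag by auto
  next
    assume "\<exists>(\<Lambda> :: nat \<Rightarrow> real^'n^'n) (R :: real^'n^'n).
        invertible R \<and> (\<forall>i\<in>{1..k}. diagonal_matrix (\<Lambda> i)) \<and>
        (\<forall>i\<in>{1..k}. A i = R ** \<Lambda> i ** transpose R)"
    then have "?comm P" using comm by (elim exE conjE)
    then show "\<forall>B\<in>V. invertible B \<longrightarrow> ?comm B" using all P(1) invP by simp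
  qed
qed

end
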